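(* Let $\lambda>0$, $\sigma>0$, $\gamma\in(-\frac\pi2,\frac\pi2)$, $\beta>0$, $C_L$, $\theta$, $\mu_L$, $\mu_G$ and $I$ be as in the context, and consider the system in the unknowns $(\varphi,a,a')$ $$\text{(S1)}\ \tan\varphi=\frac{1-a}{\lambda(1+a')},\qquad \text{(S2)}\ \frac{a}{1-a}=\frac{\mu_L(\varphi)\cos\varphi}{\sin^2\varphi},\qquad \text{(S3)}\ \frac{a'}{1-a}=\frac{\mu_L(\varphi)}{\lambda\sin\varphi}.$$ (i) If $(\varphi,a,a')\in (I\setminus\{0,\frac{\pi}{2}\})\times(\mathbb{R}\setminus\{1\})\times(\mathbb{R}\setminus\{-1\})$ satisfies (S1), (S2), (S3), then $$\mu_L(\varphi)=\mu_G(\varphi).$$ (ii) Conversely, suppose that $\varphi\in I\setminus\{0,\frac{\pi}{2}\}$ satisfies $\mu_L(\varphi)=\mu_G(\varphi)$, and define $a$ and $a'$ as the corresponding solutions of (S2) and (S3), respectively ($a$ from (S2), then $a'$ from (S3)). Then $(\varphi,a,a')\in (I\setminus\{0,\frac{\pi}{2}\})\times(\mathbb{R}\setminus\{1\})\times(\mathbb{R}\setminus\{-1\})$ and $(\varphi,a,a')$ satisfies (S1), (S2), (S3).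
   Context: Fixed data: real numbers $\lambda>0$ (local speed ratio), $\sigma>0$ (solidity), $\gamma\in(-\frac\pi2,\frac\pi2)$ (twist angle), $\beta>0$, and functions $C_L$ (lift coefficient) and $C_D$ (drag coefficient) with: $C_L:[-\beta,\beta]\to\mathbb{R}$ is continuous on $[-\beta,\beta]$ and positive on $(0,\beta]$; $C_D:\mathbb{R}\to\mathbb{R}$ is continuous and non-negative ($C_D$ plays no role in this statement). Notation: $\theta\in(0,\frac\pi2)$ is defined by $\tan\theta=1/\lambda$. $\mu_L(\varphi):=\frac{\sigma}{4}C_L(\varphi-\gamma)$ for $\varphi\in[-\beta+\gamma,\beta+\gamma]$. $\mu_G(\varphi):=\sin\varphi\,\tan(\theta-\varphi)$ for $\varphi\in(-\frac\pi2+\theta,\frac\pi2+\theta)$. $I:=[-\beta+\gamma,\beta+\gamma]\cap(-\frac\pi2+\theta,\frac\pi2+\theta)$. *)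

theory Defs
  imports Complex_Main
begin

definition mu_L :: "real \<Rightarrow> real \<Rightarrow> (real \<Rightarrow> real) \<Rightarrow> real \<Rightarrow> real" where
  "mu_L \<sigma> \<gamma> C_L \<phi> = \<sigma> / 4 * C_L (\<phi> - \<gamma>)"

definition mu_G :: "real \<Rightarrow> real \<Rightarrow> real" where
  "mu_G \<theta> \<phi> = sin \<phi> * tan (\<theta> - \<phi>)"

definition I_dom :: "real \<Rightarrow> real \<Rightarrow> real \<Rightarrow> real set" where
  "I_dom \<beta> \<gamma> \<theta> = {-\<beta> + \<gamma>..\<beta> + \<gamma>} \<inter> {-(pi/2) + \<theta><..<pi/2 + \<theta>}"

definition unknowns :: "real \<Rightarrow> real \<Rightarrow> real \<Rightarrow> (real \<times> real \<times> real) set" where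
  "unknowns \<beta> \<gamma> \<theta> = (I_dom \<beta> \<gamma> \<theta> - {0, pi/2}) \<times> (UNIV - {1}) \<times> (UNIV - {-1})"

text \<open>
  The three equations are transcribed without side conditions. As division by zero is total
  in HOL, \<open>S2\<close> and \<open>S3\<close> carry their intended meaning only for \<open>a \<noteq> 1\<close>, and \<open>S1\<close> only for
  \<open>a' \<noteq> -1\<close>; for instance, \<open>a = 1\<close> satisfies \<open>S2\<close> spuriously when its right-hand side is \<open>0\<close>.
  Hence \<open>a \<noteq> 1\<close> has to be stated wherever \<open>a\<close> is said to solve \<open>S2\<close>.
\<close>

definition S1 :: "real \<Rightarrow> real \<Rightarrow> real \<Rightarrow> real \<Rightarrow> bool" where
  "S1 lam \<phi> a a' \<longleftrightarrow> tan \<phi> = (1 - a) / (lam * (1 + a'))"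

definition S2 :: "(real \<Rightarrow> real) \<Rightarrow> real \<Rightarrow> real \<Rightarrow> bool" where
  "S2 mu \<phi> a \<longleftrightarrow> a / (1 - a) = mu \<phi> * cos \<phi> / (sin \<phi>)\<^sup>2"

definition S3 :: "real \<Rightarrow> (real \<Rightarrow> real) \<Rightarrow> real \<Rightarrow> real \<Rightarrow> real \<Rightarrow> bool" where
  "S3 lam mu \<phi> a a' \<longleftrightarrow> a' / (1 - a) = mu \<phi> / (lam * sin \<phi>)"

end

theory Submission imports Defs begin

text \<open>
  Write \<open>\<lambda> = lam\<close>, \<open>u = 1 - a\<close>, \<open>m = mu_L \<phi>\<close>, \<open>s = sin \<phi>\<close>, \<open>c = cos \<phi>\<close>. Then \<open>S2\<close> is linear in \<open>u\<close>,
  \<open>u (s\<^sup>2 + m c) = s\<^sup>2\<close>, and inserting \<open>S3\<close> into \<open>S1\<close> gives \<open>\<lambda> s + u m = c u\<close>. Eliminating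
  \<open>u\<close> leaves \<open>m (\<lambda> c + s) = s (c - \<lambda> s)\<close>, which for \<open>tan \<theta> = 1 / \<lambda>\<close> is \<open>m = s tan (\<theta> - \<phi>)\<close>.
  In the converse direction, \<open>S2\<close> is solvable because
  \<open>(s\<^sup>2 + m c) (\<lambda> c + s) = s \<noteq> 0\<close>.
\<close>

lemma S2_iff:
  assumes "a \<noteq> 1" "sin \<phi> \<noteq> 0"
  shows "S2 mu \<phi> a \<longleftrightarrow> (1 - a) * ((sin \<phi>)\<^sup>2 + mu \<phi> * cos \<phi>) = (sin \<phi>)\<^sup>2"
  using assms by (auto simp: S2_def field_simps)

lemma S3_iff:
  assumes "a \<noteq> 1" "lam \<noteq> 0" "sin \<phi> \<noteq> 0"
  shows "S3 lam mu \<phi> a a' \<longleftrightarrow> a' = (1 - a) * mu \<phi> / (lam * sin \<phi>)"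
  using assms by (auto simp: S3_def field_simps)

lemma S1_iff:
  assumes "a' \<noteq> -1" "lam \<noteq> 0" "cos \<phi> \<noteq> 0"
  shows "S1 lam \<phi> a a' \<longleftrightarrow> lam * sin \<phi> * (1 + a') = (1 - a) * cos \<phi>"
proof -
  have "lam * (1 + a') \<noteq> 0" using assms by auto
  then show ?thesis
    using assms by (simp add: S1_def tan_def frac_eq_eq mult_ac)
qed

text \<open>Inserting \<open>a'\<close> from \<open>S3\<close> into the cleared form of
  \<open>S1\<close> cancels \<open>lam * sin \<phi>\<close> in the term with \<open>a'\<close>, so
  the result is linear in \<open>1 - a\<close>.\<close>

lemma S1_S3_iff:
  assumes "S3 lam mu \<phi> a a'" "a \<noteq> 1" "a' \<noteq> -1" "lam \<noteq> 0" "sin \<phi> \<noteq> 0" "cos \<phi> \<noteq> 0"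
  shows "S1 lam \<phi> a a' \<longleftrightarrow> lam * sin \<phi> + (1 - a) * mu \<phi> = (1 - a) * cos \<phi>"
  using assms by (simp add: S1_iff S3_iff distrib_left)

text \<open>Since \<open>cos \<theta> = lam * sin \<theta>\<close>, both
  \<open>sin (\<theta> - \<phi>)\<close> and \<open>cos (\<theta> - \<phi>)\<close> have the factor
  \<open>sin \<theta>\<close>, which cancels in the tangent.\<close>

lemma mu_G_iff:
  assumes "lam > 0" "0 < \<theta>" "\<theta> < pi/2" "tan \<theta> = 1 / lam" "cos (\<theta> - \<phi>) \<noteq> 0"
  shows "m = mu_G \<theta> \<phi> \<longleftrightarrow> m * (lam * cos \<phi> + sin \<phi>) = sin \<phi> * (cos \<phi> - lam * sin \<phi>)"
    and "lam * cos \<phi> + sin \<phi> \<noteq> 0"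
proof -
  have st: "sin \<theta> \<noteq> 0" and ct: "cos \<theta> \<noteq> 0"
    using assms sin_gt_zero[of \<theta>] cos_gt_zero[of \<theta>] by auto
  have cos_eq: "cos \<theta> = lam * sin \<theta>"
    using assms ct by (simp add: tan_def field_simps)
  have c: "cos (\<theta> - \<phi>) = sin \<theta> * (lam * cos \<phi> + sin \<phi>)"
    and s: "sin (\<theta> - \<phi>) = sin \<theta> * (cos \<phi> - lam * sin \<phi>)"
    unfolding cos_diff sin_diff cos_eq by (simp_all add: algebra_simps)
  show nz: "lam * cos \<phi> + sin \<phi> \<noteq> 0"
    using c assms by auto
  have "mu_G \<theta> \<phi> = sin \<phi> * (cos \<phi> - lam * sin \<phi>) / (lam * cos \<phi> + sin \<phi>)"
    using st by (simp add: mu_G_def tan_def c s)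
  then show "m = mu_G \<theta> \<phi> \<longleftrightarrow> m * (lam * cos \<phi> + sin \<phi>) = sin \<phi> * (cos \<phi> - lam * sin \<phi>)"
    using nz by (metis nonzero_eq_divide_eq)
qed

text \<open>For \<theta> between 0 and \<open>pi/2\<close>, \<open>I_dom\<close> lies in the open
  interval from \<open>-(pi/2)\<close> to \<open>pi\<close>. There sine vanishes only at 0 and
  cosine only at \<open>pi/2\<close>, the two excluded points.\<close>

lemma I_dom_nonzero:
  assumes "\<phi> \<in> I_dom \<beta> \<gamma> \<theta> - {0, pi/2}" "0 < \<theta>" "\<theta> < pi/2"
  shows "sin \<phi> \<noteq> 0" "cos \<phi> \<noteq> 0" "cos (\<theta> - \<phi>) \<noteq> 0"
proof -
  have b: "- (pi/2) < \<phi>" "\<phi> < pi" "\<phi> \<noteq> 0" "\<phi> \<noteq> pi/2"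
    and d: "- (pi/2) < \<theta> - \<phi>" "\<theta> - \<phi> < pi/2"
    using assms by (auto simp: I_dom_def)
  show "cos (\<theta> - \<phi>) \<noteq> 0"
    using cos_gt_zero_pi[OF d] by simp
  show "sin \<phi> \<noteq> 0"
  proof (cases "\<phi> > 0")
    case True
    then show ?thesis using sin_gt_zero[of \<phi>] b by simp
  next
    case False
    then show ?thesis using sin_gt_zero[of "- \<phi>"] b by simp
  qed
  show "cos \<phi> \<noteq> 0"
  proof (cases "\<phi> < pi/2")
    case True
    then show ?thesis using cos_gt_zero_pi[of \<phi>] b by simp
  next
    case False
    then show ?thesis using cos_gt_zero_pi[of "pi - \<phi>"] b by simp
  qed
qed

theorem theorem3p1:
  fixes lam \<sigma> \<gamma> \<beta> \<theta> :: real and C_L C_D :: "real \<Rightarrow> real"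
  assumes "lam > 0" and "\<sigma> > 0" and "-(pi/2) < \<gamma>" and "\<gamma> < pi/2" and "\<beta> > 0"
    and "continuous_on {-\<beta>..\<beta>} C_L" and "\<And>x. x \<in> {0<..\<beta>} \<Longrightarrow> C_L x > 0"
    and "continuous_on UNIV C_D" and "\<And>x. C_D x \<ge> 0"
    and "0 < \<theta>" and "\<theta> < pi/2" and "tan \<theta> = 1 / lam"
  shows
    "(\<forall>\<phi> a a'. (\<phi>, a, a') \<in> unknowns \<beta> \<gamma> \<theta> \<longrightarrow>
        S1 lam \<phi> a a' \<longrightarrow> S2 (mu_L \<sigma> \<gamma> C_L) \<phi> a \<longrightarrow> S3 lam (mu_L \<sigma> \<gamma> C_L) \<phi> a a' \<longrightarrow>
        mu_L \<sigma> \<gamma> C_L \<phi> = mu_G \<theta> \<phi>)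
     \<and>
     (\<forall>\<phi> \<in> I_dom \<beta> \<gamma> \<theta> - {0, pi/2}. mu_L \<sigma> \<gamma> C_L \<phi> = mu_G \<theta> \<phi> \<longrightarrow>
        (\<exists>!a. a \<noteq> 1 \<and> S2 (mu_L \<sigma> \<gamma> C_L) \<phi> a) \<and>
        (\<forall>a. a \<noteq> 1 \<and> S2 (mu_L \<sigma> \<gamma> C_L) \<phi> a \<longrightarrow>
          (\<exists>!a'. S3 lam (mu_L \<sigma> \<gamma> C_L) \<phi> a a') \<and>
          (\<forall>a'. S3 lam (mu_L \<sigma> \<gamma> C_L) \<phi> a a' \<longrightarrow>
             (\<phi>, a, a') \<in> unknowns \<beta> \<gamma> \<theta> \<and>
             S1 lam \<phi> a a' \<and> S2 (mu_L \<sigma> \<gamma> C_L) \<phi> a \<and> S3 lam (mu_L \<sigma> \<gamma> C_L) \<phi> a a')))"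
proof (intro conjI allI ballI impI)
  let ?mu = "mu_L \<sigma> \<gamma> C_L"
  note \<theta> = \<open>lam > 0\<close> \<open>0 < \<theta>\<close> \<open>\<theta> < pi/2\<close> \<open>tan \<theta> = 1 / lam\<close>
  have lam: "lam \<noteq> 0" using \<theta> by simp
  {
    fix \<phi> a a'
    assume "(\<phi>, a, a') \<in> unknowns \<beta> \<gamma> \<theta>"
      and S: "S1 lam \<phi> a a'" "S2 ?mu \<phi> a" "S3 lam ?mu \<phi> a a'"
    then have \<phi>: "\<phi> \<in> I_dom \<beta> \<gamma> \<theta> - {0, pi/2}" and a: "a \<noteq> 1" "a' \<noteq> -1"
      by (auto simp: unknowns_def)
    note nz = I_dom_nonzero[OF \<phi> \<theta>(2,3)]
    have 1: "lam * sin \<phi> + (1 - a) * ?mu \<phi> = (1 - a) * cos \<phi>"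
      using S a lam nz by (simp add: S1_S3_iff)
    have 2: "(1 - a) * ((sin \<phi>)\<^sup>2 + ?mu \<phi> * cos \<phi>) = (sin \<phi>)\<^sup>2"
      using S a nz by (simp add: S2_iff)
    \<comment> \<open>Multiply fact 2 by \<open>lam * sin \<phi>\<close> and, on the right-hand
      side, replace one factor \<open>lam * sin \<phi>\<close> by
      \<open>(1 - a) * (cos \<phi> - ?mu \<phi>)\<close> from fact 1. The common factor
      \<open>(1 - a) * sin \<phi>\<close> is nonzero.\<close>
    have "(1 - a) * sin \<phi> * (?mu \<phi> * (lam * cos \<phi> + sin \<phi>))
        = (1 - a) * sin \<phi> * (sin \<phi> * (cos \<phi> - lam * sin \<phi>))"
      using 1 2 by algebra
    then have "?mu \<phi> * (lam * cos \<phi> + sin \<phi>) = sin \<phi> * (cos \<phi> - lam * sin \<phi>)"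
      using a nz by simp
    then show "?mu \<phi> = mu_G \<theta> \<phi>"
      using mu_G_iff(1)[OF \<theta> nz(3)] by blast
  }
  fix \<phi>
  assume \<phi>: "\<phi> \<in> I_dom \<beta> \<gamma> \<theta> - {0, pi/2}" and eq: "?mu \<phi> = mu_G \<theta> \<phi>"
  note nz = I_dom_nonzero[OF \<phi> \<theta>(2,3)]
  \<comment> \<open>\<open>E\<close> is the coefficient of \<open>1 - a\<close> in the linear form
    of \<open>S2\<close>.\<close>
  define E where "E = (sin \<phi>)\<^sup>2 + ?mu \<phi> * cos \<phi>"
  have m: "?mu \<phi> * (lam * cos \<phi> + sin \<phi>) = sin \<phi> * (cos \<phi> - lam * sin \<phi>)"
    using mu_G_iff(1)[OF \<theta> nz(3)] eq by blast
  \<comment> \<open>By \<open>m\<close>, the terms with \<open>lam\<close> cancel and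
    \<open>sin \<phi> * ((sin \<phi>)\<^sup>2 + (cos \<phi>)\<^sup>2)\<close> remains.\<close>
  have E: "E * (lam * cos \<phi> + sin \<phi>) = sin \<phi>"
    unfolding E_def using m sin_cos_squared_add[of \<phi>] by algebra
  then have "E \<noteq> 0" using nz by auto
  have a_iff: "a \<noteq> 1 \<and> S2 ?mu \<phi> a \<longleftrightarrow> a = 1 - (sin \<phi>)\<^sup>2 / E" for a
  proof -
    have "S2 ?mu \<phi> a \<longleftrightarrow> a = 1 - (sin \<phi>)\<^sup>2 / E" if "a \<noteq> 1"
      unfolding S2_iff[OF that nz(1)] E_def[symmetric] using \<open>E \<noteq> 0\<close> by (auto simp: field_simps)
    moreover have "1 - (sin \<phi>)\<^sup>2 / E \<noteq> 1"
      using nz \<open>E \<noteq> 0\<close> by simp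
    ultimately show ?thesis by metis
  qed
  then show "\<exists>!a. a \<noteq> 1 \<and> S2 ?mu \<phi> a" by simp
  fix a
  assume a: "a \<noteq> 1 \<and> S2 ?mu \<phi> a"
  then show "\<exists>!a'. S3 lam ?mu \<phi> a a'"
    using lam nz by (simp add: S3_iff)
  fix a'
  assume S3: "S3 lam ?mu \<phi> a a'"
  have u: "(1 - a) * E = (sin \<phi>)\<^sup>2"
    using a S2_iff[of a \<phi> ?mu] nz unfolding E_def by blast
  \<comment> \<open>By \<open>m\<close>,
    \<open>lam * E = sin \<phi> * (cos \<phi> - ?mu \<phi>)\<close>; multiply by
    \<open>sin \<phi>\<close> and use \<open>u\<close>.\<close>
  have "E * (lam * sin \<phi> + (1 - a) * ?mu \<phi>) = E * ((1 - a) * cos \<phi>)"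
    using u m E unfolding E_def by algebra
  then have key: "lam * sin \<phi> + (1 - a) * ?mu \<phi> = (1 - a) * cos \<phi>"
    using \<open>E \<noteq> 0\<close> by simp
  \<comment> \<open>This cleared form of \<open>S1\<close> needs no condition on \<open>a'\<close>.
    Its right-hand side is nonzero, which excludes \<open>a' = -1\<close> before the quotient in
    \<open>S1\<close> is used.\<close>
  have "lam * sin \<phi> * (1 + a') = (1 - a) * cos \<phi>"
    using S3 a lam nz key by (simp add: S3_iff distrib_left)
  then have a': "a' \<noteq> -1" using a nz by auto
  show "(\<phi>, a, a') \<in> unknowns \<beta> \<gamma> \<theta>"
    using \<phi> a a' by (auto simp: unknowns_def)
  show "S1 lam \<phi> a a'"
    using S1_S3_iff[OF S3 _ a' lam nz(1,2)] a key by blast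
  show "S2 ?mu \<phi> a" using a by blast
  show "S3 lam ?mu \<phi> a a'" by (fact S3)
qed

end
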